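(* Let $G$ be a group. Then $\mathscr{I}_c(G)$ is weakly $\alpha$-perfect, i.e. $\alpha(\mathscr{I}_c(G))=\theta(\mathscr{I}_c(G))$.
   Context: For a group $G$, the intersection graph of cyclic subgroups of $G$, denoted $\mathscr{I}_c(G)$, is the simple graph whose vertices are all the proper cyclic subgroups of $G$ (cyclic subgroups different from $G$ and from the trivial subgroup), two distinct vertices being adjacent if and only if their intersection is a non-trivial subgroup. The independence number $\alpha$ of a graph is the cardinality of its largest set of pairwise non-adjacent vertices. The clique cover number $\theta$ is the minimum number of cliques (complete subgraphs) that cover all of its vertices. A graph is weakly $\alpha$-perfect if its independence number equals its clique cover number. *)

theory Defs
  imports "HOL-Algebra.Elementary_Groups"
begin

unbundle cardinal_syntax

text \<open>Undirected simple graphs, possibly infinite; an edge is a two-element set of vertices.\<close>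

record 'v ugraph =
  vertices :: "'v set"
  edges :: "'v set set"

definition simple_graph :: "'v ugraph \<Rightarrow> bool" where
  "simple_graph \<Gamma> \<longleftrightarrow> (\<forall>e \<in> edges \<Gamma>. e \<subseteq> vertices \<Gamma> \<and> card e = 2)"

definition independent_set :: "'v ugraph \<Rightarrow> 'v set \<Rightarrow> bool" where
  "independent_set \<Gamma> S \<longleftrightarrow> S \<subseteq> vertices \<Gamma> \<and> pairwise (\<lambda>u v. {u, v} \<notin> edges \<Gamma>) S"

definition clique :: "'v ugraph \<Rightarrow> 'v set \<Rightarrow> bool" where
  "clique \<Gamma> S \<longleftrightarrow> S \<subseteq> vertices \<Gamma> \<and> pairwise (\<lambda>u v. {u, v} \<in> edges \<Gamma>) S"

definition clique_cover :: "'v ugraph \<Rightarrow> 'v set set \<Rightarrow> bool" where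
  "clique_cover \<Gamma> \<C> \<longleftrightarrow> (\<forall>S \<in> \<C>. clique \<Gamma> S) \<and> \<Union>\<C> = vertices \<Gamma>"

text \<open>
  The groups considered need not be finite, so the graph invariants are genuine cardinal
  numbers. They are represented by cardinal orders and compared up to order isomorphism;
  on finite sets this is comparison of the natural numbers \<^const>\<open>card\<close>.
\<close>

definition largest_independent_set :: "'v ugraph \<Rightarrow> 'v set \<Rightarrow> bool" where
  "largest_independent_set \<Gamma> S \<longleftrightarrow>
     independent_set \<Gamma> S \<and> (\<forall>T. independent_set \<Gamma> T \<longrightarrow> |T| \<le>o |S| )"

definition smallest_clique_cover :: "'v ugraph \<Rightarrow> 'v set set \<Rightarrow> bool" where
  "smallest_clique_cover \<Gamma> \<C> \<longleftrightarrow>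
     clique_cover \<Gamma> \<C> \<and> (\<forall>\<D>. clique_cover \<Gamma> \<D> \<longrightarrow> |\<C>| \<le>o |\<D>| )"

definition independence_number :: "'v ugraph \<Rightarrow> 'v rel" where
  "independence_number \<Gamma> = |SOME S. largest_independent_set \<Gamma> S|"

definition clique_cover_number :: "'v ugraph \<Rightarrow> 'v set rel" where
  "clique_cover_number \<Gamma> = |SOME \<C>. smallest_clique_cover \<Gamma> \<C>|"

text \<open>
  In an infinite graph there may be no independent set of largest cardinality, in which case
  \<^const>\<open>independence_number\<close> is meaningless. Its existence is therefore part of being weakly
  \<open>\<alpha>\<close>-perfect. A smallest clique cover always exists.
\<close>

definition weakly_alpha_perfect :: "'v ugraph \<Rightarrow> bool" where
  "weakly_alpha_perfect \<Gamma> \<longleftrightarrow>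
     (\<exists>S. largest_independent_set \<Gamma> S) \<and> independence_number \<Gamma> =o clique_cover_number \<Gamma>"

lemma independence_number_eq:
  assumes "largest_independent_set \<Gamma> S"
  shows "independence_number \<Gamma> =o |S|"
proof -
  have "largest_independent_set \<Gamma> (SOME S. largest_independent_set \<Gamma> S)"
    using assms by (rule someI)
  with assms show ?thesis
    unfolding independence_number_def largest_independent_set_def
    by (simp add: ordIso_iff_ordLeq)
qed

lemma smallest_clique_cover_exists: "\<exists>\<C>. smallest_clique_cover \<Gamma> \<C>"
proof -
  let ?R = "card_of ` {\<C>. clique_cover \<Gamma> \<C>}"
  have "clique_cover \<Gamma> ((\<lambda>v. {v}) ` vertices \<Gamma>)"
    by (auto simp: clique_cover_def clique_def pairwise_def)
  hence "?R \<noteq> {}" by blast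
  moreover have "\<forall>r \<in> ?R. Well_order r"
    by (auto simp: card_of_Well_order)
  ultimately obtain r where "r \<in> ?R" "\<forall>r' \<in> ?R. r \<le>o r'"
    using exists_minim_Well_order[of ?R] by blast
  thus ?thesis
    unfolding smallest_clique_cover_def by blast
qed

lemma clique_cover_number_eq:
  assumes "smallest_clique_cover \<Gamma> \<C>"
  shows "clique_cover_number \<Gamma> =o |\<C>|"
proof -
  have "smallest_clique_cover \<Gamma> (SOME \<C>. smallest_clique_cover \<Gamma> \<C>)"
    using assms by (rule someI)
  with assms show ?thesis
    unfolding clique_cover_number_def smallest_clique_cover_def
    by (simp add: ordIso_iff_ordLeq)
qed

lemma weakly_alpha_perfect_iff:
  "weakly_alpha_perfect \<Gamma> \<longleftrightarrow>
     (\<exists>S \<C>. largest_independent_set \<Gamma> S \<and> smallest_clique_cover \<Gamma> \<C> \<and> |S| =o |\<C>| )"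
  unfolding weakly_alpha_perfect_def
  by (meson independence_number_eq clique_cover_number_eq smallest_clique_cover_exists
        ordIso_symmetric ordIso_transitive)

definition proper_cyclic_subgroups :: "('a, 'b) monoid_scheme \<Rightarrow> 'a set set" where
  "proper_cyclic_subgroups G =
     {H. subgroup H G \<and> cyclic_group (G\<lparr>carrier := H\<rparr>) \<and> H \<noteq> carrier G \<and> H \<noteq> {\<one>\<^bsub>G\<^esub>}}"

definition cyclic_intersection_graph :: "('a, 'b) monoid_scheme \<Rightarrow> 'a set ugraph" where
  "cyclic_intersection_graph G =
     \<lparr>vertices = proper_cyclic_subgroups G,
      edges = {{H, K} | H K. H \<in> proper_cyclic_subgroups G \<and> K \<in> proper_cyclic_subgroups G
                             \<and> H \<noteq> K \<and> H \<inter> K \<noteq> {\<one>\<^bsub>G\<^esub>}}\<rparr>"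

lemma simple_graph_cyclic_intersection_graph: "simple_graph (cyclic_intersection_graph G)"
  by (fastforce simp: simple_graph_def cyclic_intersection_graph_def card_2_iff)

lemma (in group) cyclic_subgroup_iff:
  "subgroup H G \<and> cyclic_group (G\<lparr>carrier := H\<rparr>) \<longleftrightarrow> (\<exists>x \<in> carrier G. H = generate G {x})"
proof
  assume H: "subgroup H G \<and> cyclic_group (G\<lparr>carrier := H\<rparr>)"
  then obtain x where x: "x \<in> H" "generate (G\<lparr>carrier := H\<rparr>) (H \<inter> {x}) = H"
    unfolding cyclic_group_def
    by (metis carrier_subgroup_generated partial_object.select_convs(1)
          partial_object.surjective partial_object.update_convs(1))
  have "generate (G\<lparr>carrier := H\<rparr>) {x} = generate G {x}"
    using generate_consistent[of "{x}" H] x H by auto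
  moreover have "H \<inter> {x} = {x}" using x by blast
  ultimately show "\<exists>x \<in> carrier G. H = generate G {x}"
    using x H subgroup.mem_carrier by metis
next
  assume "\<exists>x \<in> carrier G. H = generate G {x}"
  then obtain x where x: "x \<in> carrier G" "H = generate G {x}" by blast
  hence "subgroup_generated G {x} = G\<lparr>carrier := H\<rparr>"
    by (simp add: subgroup_generated_def)
  with x show "subgroup H G \<and> cyclic_group (G\<lparr>carrier := H\<rparr>)"
    by (metis cyclic_group_generated generate_is_subgroup empty_subsetI insert_subset)
qed

end

theory Submission
  imports Defs "HOL-Algebra.Multiplicative_Group" "HOL-Computational_Algebra.Primes"
begin

text \<open>
  Call a vertex simplicial if it and its neighbours form a clique. Two adjacent simplicial
  vertices have the same closed neighbourhood, so choosing one simplicial vertex for each such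
  neighbourhood yields an independent set that is in bijection with a family of cliques. If every
  vertex is simplicial or adjacent to a simplicial vertex, that family covers the graph, and a
  clique cover equinumerous with an independent set is smallest while the independent set is
  largest. This reasoning counts nothing and so applies verbatim to infinite graphs.

  In the intersection graph, the cyclic subgroups of prime or infinite order are simplicial: if
  \<open>p\<close> is prime or zero, then \<open>p dvd m * n\<close> forces \<open>p dvd m\<close> or \<open>p dvd n\<close>, so the nontrivial
  powers \<open>y\<^sup>m\<close> and \<open>y\<^sup>n\<close> of an element \<open>y\<close> with order \<open>p\<close> (infinite if \<open>p = 0\<close>) have the
  nontrivial common power \<open>y\<^sup>m\<^sup>n\<close>. Hence subgroups meeting the group of \<open>y\<close> nontrivially meet
  each other nontrivially. Since every nontrivial cyclic subgroup contains one of these, it is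
  equal or adjacent to a simplicial vertex.
\<close>

section \<open>Graphs dominated by simplicial vertices\<close>

definition closed_neighbourhood :: "'v ugraph \<Rightarrow> 'v \<Rightarrow> 'v set" where
  "closed_neighbourhood \<Gamma> v = {u \<in> vertices \<Gamma>. u = v \<or> {u, v} \<in> edges \<Gamma>}"

definition simplicial :: "'v ugraph \<Rightarrow> 'v \<Rightarrow> bool" where
  "simplicial \<Gamma> v \<longleftrightarrow> v \<in> vertices \<Gamma> \<and> clique \<Gamma> (closed_neighbourhood \<Gamma> v)"

lemma clique_meets_independent_set_once:
  assumes "clique \<Gamma> C" "independent_set \<Gamma> S" "u \<in> C \<inter> S" "v \<in> C \<inter> S"
  shows "u = v"
  using assms unfolding clique_def independent_set_def pairwise_def by blast

text \<open>
  Weak duality: sending a vertex to a clique of the cover that contains it is injective on an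
  independent set.
\<close>

lemma independent_set_ordLeq_clique_cover:
  assumes "independent_set \<Gamma> S" "clique_cover \<Gamma> \<C>"
  shows "|S| \<le>o |\<C>|"
proof -
  have "\<forall>v \<in> S. \<exists>C \<in> \<C>. v \<in> C"
    using assms unfolding independent_set_def clique_cover_def by blast
  then obtain f where f: "\<And>v. v \<in> S \<Longrightarrow> f v \<in> \<C> \<and> v \<in> f v"
    by metis
  have "inj_on f S"
  proof (rule inj_onI)
    fix u v assume uv: "u \<in> S" "v \<in> S" "f u = f v"
    have "clique \<Gamma> (f u)"
      using f[OF uv(1)] assms(2) by (auto simp: clique_cover_def)
    with f uv assms(1) show "u = v"
      by (metis IntI clique_meets_independent_set_once)
  qed
  moreover have "f ` S \<subseteq> \<C>"
    using f by blast
  ultimately show ?thesis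
    using card_of_ordLeq by blast
qed

lemma weakly_alpha_perfectI:
  assumes "independent_set \<Gamma> S" "clique_cover \<Gamma> \<C>" "|S| =o |\<C>|"
  shows "weakly_alpha_perfect \<Gamma>"
proof -
  have "largest_independent_set \<Gamma> S"
    unfolding largest_independent_set_def
    using assms independent_set_ordLeq_clique_cover
    by (meson ordIso_symmetric ordLeq_ordIso_trans)
  moreover have "smallest_clique_cover \<Gamma> \<C>"
    unfolding smallest_clique_cover_def
    using assms independent_set_ordLeq_clique_cover
    by (meson ordIso_symmetric ordIso_ordLeq_trans)
  ultimately show ?thesis
    using assms(3) weakly_alpha_perfect_iff by blast
qed

text \<open>
  The neighbours of a simplicial vertex are adjacent to each other, so each of them sees at least
  as much as that vertex does; between two simplicial vertices this holds both ways.
\<close>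

lemma closed_neighbourhood_eq:
  assumes u: "simplicial \<Gamma> u" and v: "simplicial \<Gamma> v"
    and uv: "u \<in> closed_neighbourhood \<Gamma> v"
  shows "closed_neighbourhood \<Gamma> u = closed_neighbourhood \<Gamma> v"
proof -
  have sub: "closed_neighbourhood \<Gamma> x \<subseteq> closed_neighbourhood \<Gamma> y"
    if "simplicial \<Gamma> x" "y \<in> closed_neighbourhood \<Gamma> x" for x y
    using that unfolding simplicial_def clique_def pairwise_def closed_neighbourhood_def
    by blast
  have "v \<in> closed_neighbourhood \<Gamma> u"
    using uv v by (auto simp: closed_neighbourhood_def simplicial_def insert_commute)
  with sub u v uv show ?thesis
    by blast
qed

text \<open>
  Different simplicial vertices may share a closed neighbourhood. Keeping one for each neighbourhood
  leaves no adjacent pairs, because adjacency would force the neighbourhoods to agree.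
\<close>

theorem weakly_alpha_perfect_if_simplicial_dominating:
  assumes dom: "\<And>v. v \<in> vertices \<Gamma> \<Longrightarrow> \<exists>s. simplicial \<Gamma> s \<and> v \<in> closed_neighbourhood \<Gamma> s"
  shows "weakly_alpha_perfect \<Gamma>"
proof -
  let ?N = "closed_neighbourhood \<Gamma>"
  \<comment> \<open>The cover is indexed by neighbourhoods, not by vertices, so that \<open>r\<close> is injective on it.\<close>
  define \<C> where "\<C> = ?N ` Collect (simplicial \<Gamma>)"
  define r where "r = inv_into (Collect (simplicial \<Gamma>)) ?N"
  have r: "simplicial \<Gamma> (r C)" "?N (r C) = C" if "C \<in> \<C>" for C
    using that inv_into_into[of C ?N "Collect (simplicial \<Gamma>)"]
      f_inv_into_f[of C ?N "Collect (simplicial \<Gamma>)"]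
    by (auto simp: \<C>_def r_def)
  have "independent_set \<Gamma> (r ` \<C>)"
    unfolding independent_set_def
  proof (intro conjI pairwiseI notI)
    show "r ` \<C> \<subseteq> vertices \<Gamma>"
      using r(1) by (auto simp: simplicial_def)
  next
    fix u v assume uv: "u \<in> r ` \<C>" "v \<in> r ` \<C>" "u \<noteq> v" and edge: "{u, v} \<in> edges \<Gamma>"
    have "simplicial \<Gamma> u" "simplicial \<Gamma> v"
      using uv r(1) by auto
    moreover from this edge have "u \<in> ?N v"
      by (auto simp: closed_neighbourhood_def simplicial_def)
    ultimately have "?N u = ?N v"
      by (rule closed_neighbourhood_eq)
    with uv r(2) show False
      by fastforce
  qed
  moreover have "clique_cover \<Gamma> \<C>"
    unfolding clique_cover_def
  proof
    show "\<forall>C \<in> \<C>. clique \<Gamma> C"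
      by (auto simp: \<C>_def simplicial_def)
    have "\<Union>\<C> \<subseteq> vertices \<Gamma>"
      by (auto simp: \<C>_def closed_neighbourhood_def)
    with dom show "\<Union>\<C> = vertices \<Gamma>"
      by (fastforce simp: \<C>_def)
  qed
  moreover have "|r ` \<C>| =o |\<C>|"
  proof -
    have "bij_betw r \<C> (r ` \<C>)"
      by (metis inj_on_imp_bij_betw inj_onI r(2))
    then show ?thesis
      using card_of_ordIso ordIso_symmetric by blast
  qed
  ultimately show ?thesis
    by (rule weakly_alpha_perfectI)
qed

section \<open>Cyclic subgroups of prime or infinite order\<close>

context group
begin

text \<open>
  The value \<open>ord x = 0\<close> encodes infinite order, and then \<open>x\<close> itself serves. Otherwise the power
  of \<open>x\<close> with exponent \<open>ord x div p\<close>, for a prime divisor \<open>p\<close> of \<open>ord x\<close>, has order \<open>p\<close>.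
\<close>

lemma generate_contains_prime_or_infinite_order:
  assumes x: "x \<in> carrier G" "x \<noteq> \<one>"
  shows "\<exists>y \<in> generate G {x}. y \<noteq> \<one> \<and> (ord y = 0 \<or> prime (ord y))"
proof (cases "ord x = 0")
  case True
  with x show ?thesis
    by (auto intro!: bexI[of _ x] generate.incl)
next
  case False
  obtain p where p: "prime p" "p dvd ord x"
    using x ord_eq_1 prime_factor_nat by blast
  then obtain k where k: "ord x = p * k"
    by blast
  with False have "k \<noteq> 0" by auto
  have "ord (x [^] k) = p"
    using k \<open>k \<noteq> 0\<close> x ord_pow[of x k] by simp
  moreover from this p x have "x [^] k \<noteq> \<one>"
    by (metis not_prime_1 ord_id)
  moreover have "x [^] k \<in> generate G {x}"
    using x generate_pow[of x] by (auto simp: int_pow_int[symmetric])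
  ultimately show ?thesis
    using p by blast
qed

text \<open>
  Infinite order, encoded as \<open>0\<close>, and prime order are treated alike, because \<open>0\<close> and the primes
  both generate prime ideals of the integers: neither divides \<open>m * n\<close> without dividing a factor.
\<close>

lemma subgroups_meet_nontrivially:
  assumes y: "y \<in> carrier G" "ord y = 0 \<or> prime (ord y)"
    and H: "subgroup H G" "H \<inter> generate G {y} \<noteq> {\<one>}"
    and K: "subgroup K G" "K \<inter> generate G {y} \<noteq> {\<one>}"
  shows "H \<inter> K \<noteq> {\<one>}"
proof -
  have power: "\<exists>m::int. y [^] m \<in> L \<and> y [^] m \<noteq> \<one>"
    if "subgroup L G" "L \<inter> generate G {y} \<noteq> {\<one>}" for L
  proof -
    have "\<one> \<in> L \<inter> generate G {y}"
      using that(1) by (simp add: generate.one subgroup.one_closed)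
    with that(2) obtain z where "z \<in> L" "z \<in> generate G {y}" "z \<noteq> \<one>"
      by blast
    with generate_pow[OF y(1)] show ?thesis
      by auto
  qed
  obtain m :: int where m: "y [^] m \<in> H" "y [^] m \<noteq> \<one>"
    using power[OF H] by metis
  obtain n :: int where n: "y [^] n \<in> K" "y [^] n \<noteq> \<one>"
    using power[OF K] by metis
  have "\<not> int (ord y) dvd m" "\<not> int (ord y) dvd n"
    using m n y(1) int_pow_eq_id by auto
  moreover have "int (ord y) = 0 \<or> prime (int (ord y))"
    using y(2) by auto
  ultimately have "\<not> int (ord y) dvd m * n"
    by (auto simp: prime_dvd_mult_iff)
  then have "y [^] (m * n) \<noteq> \<one>"
    using y(1) int_pow_eq_id by auto
  moreover have "y [^] (m * n) \<in> H"
    using subgroup_int_pow_closed[OF H(1) m(1)] y(1) by (simp add: int_pow_pow)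
  moreover have "y [^] (m * n) \<in> K"
    using subgroup_int_pow_closed[OF K(1) n(1), of m] y(1) by (simp add: int_pow_pow mult.commute)
  ultimately show ?thesis
    by blast
qed

lemma edge_cyclic_intersection_graph_iff:
  "{H, K} \<in> edges (cyclic_intersection_graph G) \<longleftrightarrow>
    H \<in> proper_cyclic_subgroups G \<and> K \<in> proper_cyclic_subgroups G \<and> H \<noteq> K \<and> H \<inter> K \<noteq> {\<one>}"
proof -
  have "{H, K} \<in> edges (cyclic_intersection_graph G) \<longleftrightarrow>
    (\<exists>H' K'. {H, K} = {H', K'} \<and> H' \<in> proper_cyclic_subgroups G \<and>
      K' \<in> proper_cyclic_subgroups G \<and> H' \<noteq> K' \<and> H' \<inter> K' \<noteq> {\<one>})"
    by (simp only: cyclic_intersection_graph_def ugraph.simps mem_Collect_eq)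
  then show ?thesis
    by (metis doubleton_eq_iff Int_commute)
qed

lemma closed_neighbourhood_cyclic_intersection_graph:
  assumes "K \<in> proper_cyclic_subgroups G"
  shows "H \<in> closed_neighbourhood (cyclic_intersection_graph G) K \<longleftrightarrow>
    H \<in> proper_cyclic_subgroups G \<and> H \<inter> K \<noteq> {\<one>}"
proof -
  have "vertices (cyclic_intersection_graph G) = proper_cyclic_subgroups G"
    by (simp add: cyclic_intersection_graph_def)
  moreover have "K \<inter> K \<noteq> {\<one>}"
    using assms by (simp add: proper_cyclic_subgroups_def)
  ultimately show ?thesis
    unfolding closed_neighbourhood_def mem_Collect_eq edge_cyclic_intersection_graph_iff
    using assms by metis
qed

lemma simplicial_prime_or_infinite_order:
  assumes y: "y \<in> carrier G" "ord y = 0 \<or> prime (ord y)"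
    and vertex: "generate G {y} \<in> proper_cyclic_subgroups G"
  shows "simplicial (cyclic_intersection_graph G) (generate G {y})"
  unfolding simplicial_def clique_def
proof (intro conjI pairwiseI)
  let ?\<Gamma> = "cyclic_intersection_graph G"
  let ?N = "closed_neighbourhood ?\<Gamma> (generate G {y})"
  show "generate G {y} \<in> vertices ?\<Gamma>"
    using vertex by (simp add: cyclic_intersection_graph_def)
  show "?N \<subseteq> vertices ?\<Gamma>"
    by (auto simp: closed_neighbourhood_def)
  fix H K assume HK: "H \<in> ?N" "K \<in> ?N" "H \<noteq> K"
  then have H: "H \<in> proper_cyclic_subgroups G" "H \<inter> generate G {y} \<noteq> {\<one>}"
    and K: "K \<in> proper_cyclic_subgroups G" "K \<inter> generate G {y} \<noteq> {\<one>}"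
    using closed_neighbourhood_cyclic_intersection_graph[OF vertex] by simp_all
  then have "subgroup H G" "subgroup K G"
    by (simp_all add: proper_cyclic_subgroups_def)
  then have "H \<inter> K \<noteq> {\<one>}"
    using subgroups_meet_nontrivially[OF y] H(2) K(2) by metis
  with H(1) K(1) HK(3) show "{H, K} \<in> edges ?\<Gamma>"
    using edge_cyclic_intersection_graph_iff by metis
qed

lemma simplicial_dominating_cyclic_intersection_graph:
  assumes H: "H \<in> proper_cyclic_subgroups G"
  shows "\<exists>K. simplicial (cyclic_intersection_graph G) K \<and>
    H \<in> closed_neighbourhood (cyclic_intersection_graph G) K"
proof -
  obtain x where x: "x \<in> carrier G" "H = generate G {x}"
    using H cyclic_subgroup_iff by (auto simp: proper_cyclic_subgroups_def)
  have "x \<noteq> \<one>"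
    using H x generate_one by (auto simp: proper_cyclic_subgroups_def)
  then obtain y where y: "y \<in> H" "y \<noteq> \<one>" "ord y = 0 \<or> prime (ord y)"
    using generate_contains_prime_or_infinite_order x by blast
  let ?K = "generate G {y}"
  have sub: "subgroup H G"
    using H by (simp add: proper_cyclic_subgroups_def)
  then have "y \<in> carrier G" "?K \<subseteq> H"
    using y(1) subgroup.mem_carrier generate_subgroup_incl by auto
  have "y \<in> ?K"
    by (simp add: generate.incl)
  have K: "?K \<in> proper_cyclic_subgroups G"
  proof -
    have "subgroup ?K G \<and> cyclic_group (G\<lparr>carrier := ?K\<rparr>)"
      using cyclic_subgroup_iff \<open>y \<in> carrier G\<close> by blast
    moreover have "?K \<noteq> {\<one>}"
      using \<open>y \<in> ?K\<close> y(2) by blast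
    moreover have "?K \<noteq> carrier G"
      using \<open>?K \<subseteq> H\<close> H subgroup.subset[OF sub] by (auto simp: proper_cyclic_subgroups_def)
    ultimately show ?thesis
      by (simp add: proper_cyclic_subgroups_def)
  qed
  have "H \<inter> ?K \<noteq> {\<one>}"
    using \<open>y \<in> ?K\<close> y by blast
  with H K y(3) \<open>y \<in> carrier G\<close> show ?thesis
    using simplicial_prime_or_infinite_order closed_neighbourhood_cyclic_intersection_graph
    by blast
qed

end

theorem corollary2p4:
  fixes G (structure)
  assumes "group G"
  shows "weakly_alpha_perfect (cyclic_intersection_graph G)"
proof (rule weakly_alpha_perfect_if_simplicial_dominating)
  interpret group G by fact
  fix H assume "H \<in> vertices (cyclic_intersection_graph G)"
  then show "\<exists>K. simplicial (cyclic_intersection_graph G) K \<and>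
      H \<in> closed_neighbourhood (cyclic_intersection_graph G) K"
    by (intro simplicial_dominating_cyclic_intersection_graph)
      (simp add: cyclic_intersection_graph_def)
qed

end
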